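(* Consider the complex 3-dimensional GD algebras $G1,\ldots,G61$ with basis $e_1,e_2,e_3$ listed in the context, with parameters ranging over the domains indicated there. The nilpotent ones are exactly $G6_\alpha$, $G8_{\alpha,\beta}$ and $G11_{\alpha,\beta}$. The solvable ones are exactly (remaining parameters arbitrary in the allowed domains): $G1_\alpha$, $G6_\alpha$, $G8_{\alpha,\beta}$, $G11_{\alpha,\beta}$, $G13_{0,\beta,\gamma}$ ($\beta\ne0$), $G14_{0,\beta}$, $G15_{0,\beta}$, $G16_{0,\beta}$, $G17_0$, $G18_{\alpha,0,\gamma,\delta}$, $G19_{\alpha,\beta,0,\delta}$, $G20_{\alpha,\beta,0,\delta}$, $G21_{\alpha,\beta,\gamma,0}$, $G22_{\alpha,\beta,0}$, $G23_{\alpha,\beta,0}$, $G24_{0,\beta}$, $G25_{\alpha,0}$, $G26_{0,\beta}$, $G27_{\alpha,0}$, $G28_{0,\beta,\gamma}$, $G29_{\alpha,0,\gamma}$, $G30_0$, $G31_0$, $G32_0$, $G33_{\alpha,0}$, $G34_{0,\beta,\gamma}$, $G35_{\alpha,0,\gamma}$, $G36_0$, $G37_0$, $G38_0$, $G44$, $G45_\alpha$, $G46$, $G49$, $G52_{0,\beta,\gamma}$ ($\beta\gamma\ne0$), $G53_{\alpha,0,\gamma}$ ($\alpha\in\{0,1\}$, $\gamma\ne0$), $G54_{\alpha,0,\gamma}$ ($\alpha\in\{0,1\}$, $\gamma\ne0$), $G55_{\alpha,\beta,0}$ ($\alpha,\beta\in\{0,1\}$), $G58_{\alpha,0}$ 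($\alpha\in\{0,1\}$).
   Context: A Novikov algebra is a vector space with a bilinear product $\circ$ satisfying $(x\circ y)\circ z-x\circ(y\circ z)=(y\circ x)\circ z-y\circ(x\circ z)$ and $(x\circ y)\circ z=(x\circ z)\circ y$. A Gelfand--Dorfman (GD) algebra is a triple $(A,\circ,[\cdot,\cdot])$ such that $(A,\circ)$ is a Novikov algebra, $(A,[\cdot,\cdot])$ is a Lie algebra, and for all $x,y,z\in A$: $[x,y\circ z]-[z,y\circ x]+[y,x]\circ z-[y,z]\circ x-y\circ[x,z]=0$. $A$ is solvable if $A^{(N)}=0$ for some $N\ge0$, where $A^{(0)}=A$, $A^{(n+1)}=A^{(n)}\circ A^{(n)}+[A^{(n)},A^{(n)}]$ (linear spans). $A$ is nilpotent if $A^{\langle N\rangle}=0$ for some $N\ge1$, where $A^{\langle1\rangle}=A$, $A^{\langle n+1\rangle}=\sum_{i=1}^n\bigl(A^{\langle i\rangle}\circ A^{\langle n+1-i\rangle}+[A^{\langle i\rangle},A^{\langle n+1-i\rangle}]\bigr)$. List of algebras. Brackets and products of basis vectors not displayed are zero (up to skew-symmetry of the bracket); write $e_ie_j$ for $e_i\circ e_j$; parameters are arbitrary complex numbers unless restricted. With $[e_1,e_2]=e_3$: $G1_\alpha$: $e_1e_2=e_2+\alpha e_3$, $e_1e_3=e_3$. $G2_\alpha$: $e_1e_1=e_3$, $e_1e_2=e_1$, $e_2e_1=e_1+\alpha e_3$, $e_2e_2=e_2$, $e_2e_3=e_3$, $e_3e_2=e_3$. $G3_{\alpha,\beta}$ ($\alpha\ne0$):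 $e_1e_1=e_1$, $e_1e_2=\alpha e_2+\beta e_3$, $e_1e_3=\alpha e_3$, $e_2e_1=e_2$, $e_3e_1=e_3$. $G4_\alpha$: $e_1e_1=e_1+e_2$, $e_1e_2=\alpha e_3$, $e_2e_1=e_2$, $e_3e_1=e_3$. $G5$: $e_1e_1=e_1+e_3$, $e_2e_1=e_2$, $e_3e_1=e_3$. $G6_\alpha$: $e_1e_2=-\alpha e_3$, $e_2e_1=\alpha e_3$. $G7$: $e_1e_1=e_1$, $e_1e_2=-e_2$, $e_2e_1=e_2$. $G8_{\alpha,\beta}$: $e_1e_2=\alpha e_3$, $e_2e_1=\beta e_3$, $e_2e_2=e_1$. $G9$: $e_2e_2=e_2+e_3$, $e_3e_2=e_3$. $G10$: $e_2e_2=e_2$, $e_3e_2=e_3$. $G11_{\alpha,\beta}$: $e_1e_1=\alpha e_3$, $e_1e_2=\beta e_3$, $e_2e_2=e_3$. $G12_\alpha$: $e_1e_1=e_1$, $e_1e_2=\alpha e_3$, $e_2e_1=e_2$, $e_3e_1=e_3$. With $[e_1,e_3]=e_1$, $[e_2,e_3]=e_2$: $G13_{\alpha,\beta,\gamma}$ ($\beta\ne0$): $e_1e_3=\alpha e_1$, $e_2e_3=\alpha e_2$, $e_3e_1=\beta e_2$, $e_3e_2=e_1+\gamma e_2$, $e_3e_3=\alpha e_3$. $G14_{\alpha,\beta}$: $e_1e_3=\alpha e_1$, $e_2e_3=\alpha e_2$, $e_3e_2=e_1+\beta e_2$, $e_3e_3=e_2+\alpha e_3$. $G15_{\alpha,\beta}$: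 $e_1e_3=\alpha e_1$, $e_2e_3=\alpha e_2$, $e_3e_2=e_1+\beta e_2$, $e_3e_3=\alpha e_3$. $G16_{\alpha,\beta}$: $e_1e_3=\alpha e_1$, $e_2e_3=\alpha e_2$, $e_3e_1=\beta e_1$, $e_3e_2=\beta e_2$, $e_3e_3=\alpha e_3$. $G17_\alpha$: $e_1e_3=\alpha e_1$, $e_2e_3=\alpha e_2$, $e_3e_3=e_1+\alpha e_3$. With $[e_1,e_3]=e_1$, $[e_2,e_3]=\alpha e_2$, $\alpha\in\mathbb C\setminus\{0,1,-1\}$: $G18_{\alpha,\beta,\gamma,\delta}$ ($\gamma\delta\ne0$): $e_1e_3=\beta e_1$, $e_2e_3=\beta e_2$, $e_3e_1=\gamma e_1$, $e_3e_2=\delta e_2$, $e_3e_3=\beta e_3$. $G19_{\alpha,\beta,\gamma,\delta}$ ($\beta\in\{0,1\}$, $\delta\ne0$): $e_1e_3=\gamma e_1$, $e_2e_3=\gamma e_2$, $e_3e_2=\delta e_2$, $e_3e_3=\beta e_1+\gamma e_3$. $G20_{\alpha,\beta,\gamma,\delta}$ ($\beta\in\{0,1\}$, $\delta\ne0$): $e_1e_3=\gamma e_1$, $e_2e_3=\gamma e_2$, $e_3e_1=\delta e_1$, $e_3e_3=\beta e_2+\gamma e_3$. $G21_{\alpha,\beta,\gamma,\delta}$ ($\beta,\gamma\in\{0,1\}$): $e_1e_3=\delta e_1$, $e_2e_3=\delta e_2$, $e_3e_3=\beta e_1+\gamma e_2+\delta e_3$. $G22_{\alpha,\beta,\gamma}$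 ($\beta\in\{0,1\}$): $e_1e_3=\gamma e_1$, $e_2e_3=e_1+\gamma e_2$, $e_3e_1=-\gamma e_1$, $e_3e_2=-\frac{\alpha}{\alpha-1}e_1$, $e_3e_3=\beta e_2+\gamma e_3$. $G23_{\alpha,\beta,\gamma}$ ($\beta\in\{0,1\}$): $e_1e_3=\gamma e_1+e_2$, $e_2e_3=\gamma e_2$, $e_3e_1=\frac{1}{\alpha-1}e_2$, $e_3e_2=-\gamma e_2$, $e_3e_3=\beta e_1+\gamma e_3$. With $[e_1,e_3]=e_1$, $[e_2,e_3]=2e_2$: $G24_{\alpha,\beta}$ ($\alpha\ne2\beta$): $e_1e_1=e_2$, $e_1e_3=\alpha e_1$, $e_2e_3=\alpha e_2$, $e_3e_1=\beta e_1$, $e_3e_2=(-\alpha+2\beta)e_2$, $e_3e_3=\alpha e_3$. $G25_{\alpha,\beta}$ ($\alpha\in\{0,1\}$): $e_1e_1=e_2$, $e_1e_3=2\beta e_1$, $e_2e_3=2\beta e_2$, $e_3e_1=\beta e_1$, $e_3e_3=\alpha e_2+2\beta e_3$. With $[e_1,e_3]=e_1$, $[e_2,e_3]=\frac12e_2$: $G26_{\alpha,\beta}$ ($\beta\ne0$): $e_2e_2=e_1$, $e_1e_3=\alpha e_1$, $e_2e_3=\alpha e_2$, $e_3e_1=\beta e_1$, $e_3e_2=\frac{\alpha+\beta}{2}e_2$, $e_3e_3=\alpha e_3$. $G27_{\alpha,\beta}$ ($\alpha\in\{0,1\}$): $e_2e_2=e_1$, $e_1e_3=\beta e_1$, $e_2e_3=\beta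 e_2$, $e_3e_2=\frac{\beta}{2}e_2$, $e_3e_3=\alpha e_1+\beta e_3$. With $[e_1,e_3]=e_1$, $[e_2,e_3]=-e_2$: $G28_{\alpha,\beta,\gamma}$ ($\beta\gamma\ne0$): $e_1e_3=\alpha e_1$, $e_2e_3=\alpha e_2$, $e_3e_1=\beta e_1$, $e_3e_2=\gamma e_2$, $e_3e_3=\alpha e_3$. $G29_{\alpha,\beta,\gamma}$ ($\alpha\in\{0,1\}$, $\gamma\ne0$): $e_1e_3=\beta e_1$, $e_2e_3=\beta e_2$, $e_3e_2=\gamma e_2$, $e_3e_3=\alpha e_1+\beta e_3$. $G30_\alpha$: $e_1e_3=\alpha e_1$, $e_2e_3=\alpha e_2$, $e_3e_3=\alpha e_3$. $G31_\alpha$: $e_1e_3=\alpha e_1$, $e_2e_3=\alpha e_2$, $e_3e_3=e_1+e_2+\alpha e_3$. $G32_\alpha$: $e_1e_3=\alpha e_1$, $e_2e_3=\alpha e_2$, $e_3e_3=e_1+\alpha e_3$. $G33_{\alpha,\beta}$ ($\alpha\in\{0,1\}$): $e_1e_3=\beta e_1$, $e_2e_3=e_1+\beta e_2$, $e_3e_1=-\beta e_1$, $e_3e_2=-\frac12e_1$, $e_3e_3=\alpha e_2+\beta e_3$. With $[e_1,e_3]=e_1+e_2$, $[e_2,e_3]=e_2$: $G34_{\alpha,\beta,\gamma}$ ($\beta\ne0$): $e_1e_3=\alpha e_1$, $e_2e_3=\alpha e_2$, $e_3e_1=\beta e_1+\gamma e_2$, $e_3e_2=\beta e_2$, $e_3e_3=\alpha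 e_3$. $G35_{\alpha,\beta,\gamma}$ ($\alpha\in\{0,1\}$, $\gamma\ne0$): $e_1e_3=\beta e_1$, $e_2e_3=\beta e_2$, $e_3e_1=\gamma e_2$, $e_3e_3=\alpha e_1+\beta e_3$. $G36_\alpha$: $e_1e_3=\alpha e_1$, $e_2e_3=\alpha e_2$, $e_3e_3=\alpha e_3$. $G37_\alpha$: $e_1e_3=\alpha e_1$, $e_2e_3=\alpha e_2$, $e_3e_3=e_1+\alpha e_3$. $G38_\alpha$: $e_1e_3=\alpha e_1$, $e_2e_3=\alpha e_2$, $e_3e_3=e_2+\alpha e_3$. $G39_\alpha$ ($\alpha\ne0$): $e_1e_3=\alpha(e_1+e_2)$, $e_2e_3=\alpha e_2$, $e_3e_2=-\alpha e_2$, $e_3e_3=\alpha e_3$. $G40_\alpha$ ($\alpha\ne0$): $e_1e_3=\alpha(e_1+e_2)$, $e_2e_3=\alpha e_2$, $e_3e_2=-\alpha e_2$, $e_3e_3=e_1+\alpha e_3$. With $[e_1,e_3]=e_1$ only: $G41_\alpha$ ($\alpha\in\mathbb C\setminus\{0,-1\}$): $e_1e_2=e_1$, $e_2e_1=\alpha e_1$, $e_2e_2=e_2$, $e_3e_2=e_3$. $G42_\alpha$ ($\alpha\in\{0,1\}$): $e_1e_2=e_1$, $e_2e_2=e_2$, $e_2e_3=\alpha e_1$, $e_3e_2=e_3$. $G43_\alpha$ ($\alpha\in\{0,1\}$): $e_1e_2=e_1$, $e_2e_1=-e_1$, $e_2e_2=e_2$, $e_3e_2=e_3$, $e_3e_3=\alpha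 e_1$. $G44$: $e_1e_3=e_2$, $e_3e_1=-e_2$. $G45_\alpha$: $e_1e_3=e_2$, $e_3e_1=-e_2$, $e_3e_3=e_1+\alpha e_2$. $G46$: $e_1e_3=e_2$, $e_3e_1=-e_2$, $e_3e_3=e_2$. $G47_\alpha$ ($\alpha\ne0$): $e_1e_3=\alpha e_1+e_2$, $e_3e_1=-\alpha e_1-e_2$, $e_3e_3=\alpha e_3$. $G48_{\alpha,\beta}$ ($\alpha\in\{0,1\}$, $\beta\ne0$): $e_1e_3=\beta e_1+e_2$, $e_2e_3=\beta e_2$, $e_3e_1=-e_2$, $e_3e_2=-\beta e_2$, $e_3e_3=\alpha e_1+\beta e_3$. $G49$: $e_2e_1=e_1$. $G50_{\alpha,\beta}$ ($\beta\ne0$): $e_1e_3=\alpha e_1$, $e_2e_2=e_2$, $e_3e_1=\beta e_1$, $e_3e_3=\alpha e_3$. $G51_{\alpha,\beta}$ ($\alpha\in\{0,1\}$): $e_1e_3=\beta e_1$, $e_2e_2=e_2$, $e_3e_3=\alpha e_1+\beta e_3$. $G52_{\alpha,\beta,\gamma}$ ($\beta\gamma\ne0$): $e_1e_3=\alpha e_1$, $e_2e_3=\alpha e_2$, $e_3e_1=\beta e_1$, $e_3e_2=\gamma e_2$, $e_3e_3=\alpha e_3$. $G53_{\alpha,\beta,\gamma}$ ($\alpha\in\{0,1\}$, $\gamma\ne0$): $e_1e_3=\beta e_1$, $e_2e_3=\beta e_2$, $e_3e_1=\gamma e_1$, $e_3e_3=\alpha e_2+\beta e_3$. $G54_{\alpha,\beta,\gamma}$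 ($\alpha\in\{0,1\}$, $\gamma\ne0$): $e_1e_3=\beta e_1$, $e_2e_3=\beta e_2$, $e_3e_2=\gamma e_2$, $e_3e_3=\alpha e_1+\beta e_3$. $G55_{\alpha,\beta,\gamma}$ ($\alpha,\beta\in\{0,1\}$): $e_1e_3=\gamma e_1$, $e_2e_3=\gamma e_2$, $e_3e_3=\alpha e_1+\beta e_2+\gamma e_3$. $G56_{\alpha,\beta}$ ($\alpha\beta\ne0$): $e_1e_3=\alpha e_1$, $e_3e_1=\beta e_1$, $e_3e_3=\alpha e_3$. $G57_{\alpha,\beta}$ ($\alpha\in\{0,1\}$, $\beta\ne0$): $e_1e_3=\beta e_1$, $e_3e_3=\alpha e_1+\beta e_3$. $G58_{\alpha,\beta}$ ($\alpha\in\{0,1\}$): $e_1e_3=\beta e_1$, $e_2e_3=e_1$, $e_3e_3=\alpha e_2+\beta e_3$. $G59_{\alpha,\beta}$ ($\alpha\in\{0,1\}$, $\beta\ne0$): $e_1e_3=\beta e_1$, $e_2e_3=e_1+\beta e_2$, $e_3e_1=-\beta e_1$, $e_3e_3=\alpha e_2+\beta e_3$. With $[e_1,e_2]=e_3$, $[e_1,e_3]=-e_2$, $[e_2,e_3]=e_1$: $G60$: all products $\circ$ zero. $G61$: $e_2e_2=-\frac14e_3$, $e_2e_3=e_1$, $e_3e_2=-\frac12e_1$. *)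

theory Defs
  imports "HOL-Analysis.Analysis" "HOL-Library.Set_Algebras"
begin

section \<open>Gelfand--Dorfman algebras\<close>

text \<open>
  Algebras live on the coordinate spaces \<open>'k ^ 'n\<close> over a field \<open>'k\<close>; all spans are taken over \<open>'k\<close>
  (\<open>vec.span\<close>, not the real \<open>span\<close>).
\<close>

type_synonym ('k, 'n) binop = "'k ^ 'n \<Rightarrow> 'k ^ 'n \<Rightarrow> 'k ^ 'n"

definition bilinear_op :: "('k::field, 'n::finite) binop \<Rightarrow> bool" where
  "bilinear_op f \<longleftrightarrow>
     (\<forall>y. Vector_Spaces.linear (*s) (*s) (\<lambda>x. f x y)) \<and>
     (\<forall>x. Vector_Spaces.linear (*s) (*s) (\<lambda>y. f x y))"

definition novikov_algebra :: "('k::field, 'n::finite) binop \<Rightarrow> bool" where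
  "novikov_algebra m \<longleftrightarrow> bilinear_op m \<and>
     (\<forall>x y z. m (m x y) z - m x (m y z) = m (m y x) z - m y (m x z)) \<and>
     (\<forall>x y z. m (m x y) z = m (m x z) y)"

definition lie_algebra :: "('k::field, 'n::finite) binop \<Rightarrow> bool" where
  "lie_algebra b \<longleftrightarrow> bilinear_op b \<and>
     (\<forall>x. b x x = 0) \<and>
     (\<forall>x y z. b x (b y z) + b y (b z x) + b z (b x y) = 0)"

definition gd_algebra :: "('k::field, 'n::finite) binop \<Rightarrow> ('k, 'n) binop \<Rightarrow> bool" where
  "gd_algebra m b \<longleftrightarrow> novikov_algebra m \<and> lie_algebra b \<and>
     (\<forall>x y z. b x (m y z) - b z (m y x) + m (b y x) z - m (b y z) x - m y (b x z) = 0)"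

definition span_prod :: "('k::field, 'n::finite) binop \<Rightarrow> ('k ^ 'n) set \<Rightarrow> ('k ^ 'n) set \<Rightarrow> ('k ^ 'n) set" where
  "span_prod f U V = vec.span {f x y | x y. x \<in> U \<and> y \<in> V}"

text \<open>
  Below, \<open>+\<close> and \<open>\<Sum>\<close> on sets are the elementwise sums of "HOL-Library.Set_Algebras".
\<close>

primrec derived_series ::
  "('k::field, 'n::finite) binop \<Rightarrow> ('k, 'n) binop \<Rightarrow> nat \<Rightarrow> ('k ^ 'n) set" where
  "derived_series m b 0 = UNIV"
| "derived_series m b (Suc n) =
     span_prod m (derived_series m b n) (derived_series m b n) +
     span_prod b (derived_series m b n) (derived_series m b n)"

definition solvable :: "('k::field, 'n::finite) binop \<Rightarrow> ('k, 'n) binop \<Rightarrow> bool" where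
  "solvable m b \<longleftrightarrow> (\<exists>N. derived_series m b N = {0})"

text \<open>The series starts at index 1; the value at index 0 is a dummy.\<close>

fun lower_series ::
  "('k::field, 'n::finite) binop \<Rightarrow> ('k, 'n) binop \<Rightarrow> nat \<Rightarrow> ('k ^ 'n) set" where
  "lower_series m b 0 = UNIV"
| "lower_series m b (Suc 0) = UNIV"
| "lower_series m b (Suc (Suc n)) =
     (\<Sum>i = 1..Suc n.
        span_prod m (lower_series m b i) (lower_series m b (Suc (Suc n) - i)) +
        span_prod b (lower_series m b i) (lower_series m b (Suc (Suc n) - i)))"

definition nilpotent :: "('k::field, 'n::finite) binop \<Rightarrow> ('k, 'n) binop \<Rightarrow> bool" where
  "nilpotent m b \<longleftrightarrow> (\<exists>N\<ge>1. lower_series m b N = {0})"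


section \<open>The list of algebras\<close>

text \<open>
  Labels of the algebras; the constructor arguments are the parameters
  \<open>\<alpha>, \<beta>, \<gamma>, \<delta>\<close> in this order. The restrictions on the parameters are in \<open>admissible\<close>.
\<close>

datatype (plugins only:) gd_label =
    G1 complex
  | G2 complex
  | G3 complex complex
  | G4 complex
  | G5
  | G6 complex
  | G7
  | G8 complex complex
  | G9
  | G10
  | G11 complex complex
  | G12 complex
  | G13 complex complex complex
  | G14 complex complex
  | G15 complex complex
  | G16 complex complex
  | G17 complex
  | G18 complex complex complex complex
  | G19 complex complex complex complex
  | G20 complex complex complex complex
  | G21 complex complex complex complex
  | G22 complex complex complex
  | G23 complex complex complex
  | G24 complex complex
  | G25 complex complex
  | G26 complex complex
  | G27 complex complex
  | G28 complex complex complex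
  | G29 complex complex complex
  | G30 complex
  | G31 complex
  | G32 complex
  | G33 complex complex
  | G34 complex complex complex
  | G35 complex complex complex
  | G36 complex
  | G37 complex
  | G38 complex
  | G39 complex
  | G40 complex
  | G41 complex
  | G42 complex
  | G43 complex
  | G44
  | G45 complex
  | G46
  | G47 complex
  | G48 complex complex
  | G49
  | G50 complex complex
  | G51 complex complex
  | G52 complex complex complex
  | G53 complex complex complex
  | G54 complex complex complex
  | G55 complex complex complex
  | G56 complex complex
  | G57 complex complex
  | G58 complex complex
  | G59 complex complex
  | G60
  | G61

primrec admissible :: "gd_label \<Rightarrow> bool" where
  "admissible (G1 \<alpha>) \<longleftrightarrow> True"
| "admissible (G2 \<alpha>) \<longleftrightarrow> True"
| "admissible (G3 \<alpha> \<beta>) \<longleftrightarrow> \<alpha> \<noteq> 0"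
| "admissible (G4 \<alpha>) \<longleftrightarrow> True"
| "admissible G5 \<longleftrightarrow> True"
| "admissible (G6 \<alpha>) \<longleftrightarrow> True"
| "admissible G7 \<longleftrightarrow> True"
| "admissible (G8 \<alpha> \<beta>) \<longleftrightarrow> True"
| "admissible G9 \<longleftrightarrow> True"
| "admissible G10 \<longleftrightarrow> True"
| "admissible (G11 \<alpha> \<beta>) \<longleftrightarrow> True"
| "admissible (G12 \<alpha>) \<longleftrightarrow> True"
| "admissible (G13 \<alpha> \<beta> \<gamma>) \<longleftrightarrow> \<beta> \<noteq> 0"
| "admissible (G14 \<alpha> \<beta>) \<longleftrightarrow> True"
| "admissible (G15 \<alpha> \<beta>) \<longleftrightarrow> True"
| "admissible (G16 \<alpha> \<beta>) \<longleftrightarrow> True"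
| "admissible (G17 \<alpha>) \<longleftrightarrow> True"
| "admissible (G18 \<alpha> \<beta> \<gamma> \<delta>) \<longleftrightarrow> \<alpha> \<notin> {0, 1, -1} \<and> \<gamma> * \<delta> \<noteq> 0"
| "admissible (G19 \<alpha> \<beta> \<gamma> \<delta>) \<longleftrightarrow> \<alpha> \<notin> {0, 1, -1} \<and> \<beta> \<in> {0, 1} \<and> \<delta> \<noteq> 0"
| "admissible (G20 \<alpha> \<beta> \<gamma> \<delta>) \<longleftrightarrow> \<alpha> \<notin> {0, 1, -1} \<and> \<beta> \<in> {0, 1} \<and> \<delta> \<noteq> 0"
| "admissible (G21 \<alpha> \<beta> \<gamma> \<delta>) \<longleftrightarrow> \<alpha> \<notin> {0, 1, -1} \<and> \<beta> \<in> {0, 1} \<and> \<gamma> \<in> {0, 1}"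
| "admissible (G22 \<alpha> \<beta> \<gamma>) \<longleftrightarrow> \<alpha> \<notin> {0, 1, -1} \<and> \<beta> \<in> {0, 1}"
| "admissible (G23 \<alpha> \<beta> \<gamma>) \<longleftrightarrow> \<alpha> \<notin> {0, 1, -1} \<and> \<beta> \<in> {0, 1}"
| "admissible (G24 \<alpha> \<beta>) \<longleftrightarrow> \<alpha> \<noteq> 2 * \<beta>"
| "admissible (G25 \<alpha> \<beta>) \<longleftrightarrow> \<alpha> \<in> {0, 1}"
| "admissible (G26 \<alpha> \<beta>) \<longleftrightarrow> \<beta> \<noteq> 0"
| "admissible (G27 \<alpha> \<beta>) \<longleftrightarrow> \<alpha> \<in> {0, 1}"
| "admissible (G28 \<alpha> \<beta> \<gamma>) \<longleftrightarrow> \<beta> * \<gamma> \<noteq> 0"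
| "admissible (G29 \<alpha> \<beta> \<gamma>) \<longleftrightarrow> \<alpha> \<in> {0, 1} \<and> \<gamma> \<noteq> 0"
| "admissible (G30 \<alpha>) \<longleftrightarrow> True"
| "admissible (G31 \<alpha>) \<longleftrightarrow> True"
| "admissible (G32 \<alpha>) \<longleftrightarrow> True"
| "admissible (G33 \<alpha> \<beta>) \<longleftrightarrow> \<alpha> \<in> {0, 1}"
| "admissible (G34 \<alpha> \<beta> \<gamma>) \<longleftrightarrow> \<beta> \<noteq> 0"
| "admissible (G35 \<alpha> \<beta> \<gamma>) \<longleftrightarrow> \<alpha> \<in> {0, 1} \<and> \<gamma> \<noteq> 0"
| "admissible (G36 \<alpha>) \<longleftrightarrow> True"
| "admissible (G37 \<alpha>) \<longleftrightarrow> True"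
| "admissible (G38 \<alpha>) \<longleftrightarrow> True"
| "admissible (G39 \<alpha>) \<longleftrightarrow> \<alpha> \<noteq> 0"
| "admissible (G40 \<alpha>) \<longleftrightarrow> \<alpha> \<noteq> 0"
| "admissible (G41 \<alpha>) \<longleftrightarrow> \<alpha> \<notin> {0, -1}"
| "admissible (G42 \<alpha>) \<longleftrightarrow> \<alpha> \<in> {0, 1}"
| "admissible (G43 \<alpha>) \<longleftrightarrow> \<alpha> \<in> {0, 1}"
| "admissible G44 \<longleftrightarrow> True"
| "admissible (G45 \<alpha>) \<longleftrightarrow> True"
| "admissible G46 \<longleftrightarrow> True"
| "admissible (G47 \<alpha>) \<longleftrightarrow> \<alpha> \<noteq> 0"
| "admissible (G48 \<alpha> \<beta>) \<longleftrightarrow> \<alpha> \<in> {0, 1} \<and> \<beta> \<noteq> 0"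
| "admissible G49 \<longleftrightarrow> True"
| "admissible (G50 \<alpha> \<beta>) \<longleftrightarrow> \<beta> \<noteq> 0"
| "admissible (G51 \<alpha> \<beta>) \<longleftrightarrow> \<alpha> \<in> {0, 1}"
| "admissible (G52 \<alpha> \<beta> \<gamma>) \<longleftrightarrow> \<beta> * \<gamma> \<noteq> 0"
| "admissible (G53 \<alpha> \<beta> \<gamma>) \<longleftrightarrow> \<alpha> \<in> {0, 1} \<and> \<gamma> \<noteq> 0"
| "admissible (G54 \<alpha> \<beta> \<gamma>) \<longleftrightarrow> \<alpha> \<in> {0, 1} \<and> \<gamma> \<noteq> 0"
| "admissible (G55 \<alpha> \<beta> \<gamma>) \<longleftrightarrow> \<alpha> \<in> {0, 1} \<and> \<beta> \<in> {0, 1}"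
| "admissible (G56 \<alpha> \<beta>) \<longleftrightarrow> \<alpha> * \<beta> \<noteq> 0"
| "admissible (G57 \<alpha> \<beta>) \<longleftrightarrow> \<alpha> \<in> {0, 1} \<and> \<beta> \<noteq> 0"
| "admissible (G58 \<alpha> \<beta>) \<longleftrightarrow> \<alpha> \<in> {0, 1}"
| "admissible (G59 \<alpha> \<beta>) \<longleftrightarrow> \<alpha> \<in> {0, 1} \<and> \<beta> \<noteq> 0"
| "admissible G60 \<longleftrightarrow> True"
| "admissible G61 \<longleftrightarrow> True"

abbreviation e1 :: "complex ^ 3" where "e1 \<equiv> axis 1 1"
abbreviation e2 :: "complex ^ 3" where "e2 \<equiv> axis 2 1"
abbreviation e3 :: "complex ^ 3" where "e3 \<equiv> axis 3 1"

text \<open>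
  An entry \<open>(i, j, v)\<close> of a table means $e_i \circ e_j = v$, respectively $[e_i, e_j] = v$.
  No pair \<open>(i, j)\<close> occurs twice; pairs not displayed have value zero, and for the bracket only
  pairs with $i < j$ are displayed.
\<close>

primrec bracket_table :: "gd_label \<Rightarrow> (3 \<times> 3 \<times> (complex ^ 3)) list" where
  "bracket_table (G1 \<alpha>) = [(1, 2, e3)]"
| "bracket_table (G2 \<alpha>) = [(1, 2, e3)]"
| "bracket_table (G3 \<alpha> \<beta>) = [(1, 2, e3)]"
| "bracket_table (G4 \<alpha>) = [(1, 2, e3)]"
| "bracket_table G5 = [(1, 2, e3)]"
| "bracket_table (G6 \<alpha>) = [(1, 2, e3)]"
| "bracket_table G7 = [(1, 2, e3)]"
| "bracket_table (G8 \<alpha> \<beta>) = [(1, 2, e3)]"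
| "bracket_table G9 = [(1, 2, e3)]"
| "bracket_table G10 = [(1, 2, e3)]"
| "bracket_table (G11 \<alpha> \<beta>) = [(1, 2, e3)]"
| "bracket_table (G12 \<alpha>) = [(1, 2, e3)]"
| "bracket_table (G13 \<alpha> \<beta> \<gamma>) = [(1, 3, e1), (2, 3, e2)]"
| "bracket_table (G14 \<alpha> \<beta>) = [(1, 3, e1), (2, 3, e2)]"
| "bracket_table (G15 \<alpha> \<beta>) = [(1, 3, e1), (2, 3, e2)]"
| "bracket_table (G16 \<alpha> \<beta>) = [(1, 3, e1), (2, 3, e2)]"
| "bracket_table (G17 \<alpha>) = [(1, 3, e1), (2, 3, e2)]"
| "bracket_table (G18 \<alpha> \<beta> \<gamma> \<delta>) = [(1, 3, e1), (2, 3, \<alpha> *s e2)]"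
| "bracket_table (G19 \<alpha> \<beta> \<gamma> \<delta>) = [(1, 3, e1), (2, 3, \<alpha> *s e2)]"
| "bracket_table (G20 \<alpha> \<beta> \<gamma> \<delta>) = [(1, 3, e1), (2, 3, \<alpha> *s e2)]"
| "bracket_table (G21 \<alpha> \<beta> \<gamma> \<delta>) = [(1, 3, e1), (2, 3, \<alpha> *s e2)]"
| "bracket_table (G22 \<alpha> \<beta> \<gamma>) = [(1, 3, e1), (2, 3, \<alpha> *s e2)]"
| "bracket_table (G23 \<alpha> \<beta> \<gamma>) = [(1, 3, e1), (2, 3, \<alpha> *s e2)]"
| "bracket_table (G24 \<alpha> \<beta>) = [(1, 3, e1), (2, 3, 2 *s e2)]"
| "bracket_table (G25 \<alpha> \<beta>) = [(1, 3, e1), (2, 3, 2 *s e2)]"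
| "bracket_table (G26 \<alpha> \<beta>) = [(1, 3, e1), (2, 3, (1/2) *s e2)]"
| "bracket_table (G27 \<alpha> \<beta>) = [(1, 3, e1), (2, 3, (1/2) *s e2)]"
| "bracket_table (G28 \<alpha> \<beta> \<gamma>) = [(1, 3, e1), (2, 3, - e2)]"
| "bracket_table (G29 \<alpha> \<beta> \<gamma>) = [(1, 3, e1), (2, 3, - e2)]"
| "bracket_table (G30 \<alpha>) = [(1, 3, e1), (2, 3, - e2)]"
| "bracket_table (G31 \<alpha>) = [(1, 3, e1), (2, 3, - e2)]"
| "bracket_table (G32 \<alpha>) = [(1, 3, e1), (2, 3, - e2)]"
| "bracket_table (G33 \<alpha> \<beta>) = [(1, 3, e1), (2, 3, - e2)]"
| "bracket_table (G34 \<alpha> \<beta> \<gamma>) = [(1, 3, e1 + e2), (2, 3, e2)]"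
| "bracket_table (G35 \<alpha> \<beta> \<gamma>) = [(1, 3, e1 + e2), (2, 3, e2)]"
| "bracket_table (G36 \<alpha>) = [(1, 3, e1 + e2), (2, 3, e2)]"
| "bracket_table (G37 \<alpha>) = [(1, 3, e1 + e2), (2, 3, e2)]"
| "bracket_table (G38 \<alpha>) = [(1, 3, e1 + e2), (2, 3, e2)]"
| "bracket_table (G39 \<alpha>) = [(1, 3, e1 + e2), (2, 3, e2)]"
| "bracket_table (G40 \<alpha>) = [(1, 3, e1 + e2), (2, 3, e2)]"
| "bracket_table (G41 \<alpha>) = [(1, 3, e1)]"
| "bracket_table (G42 \<alpha>) = [(1, 3, e1)]"
| "bracket_table (G43 \<alpha>) = [(1, 3, e1)]"
| "bracket_table G44 = [(1, 3, e1)]"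
| "bracket_table (G45 \<alpha>) = [(1, 3, e1)]"
| "bracket_table G46 = [(1, 3, e1)]"
| "bracket_table (G47 \<alpha>) = [(1, 3, e1)]"
| "bracket_table (G48 \<alpha> \<beta>) = [(1, 3, e1)]"
| "bracket_table G49 = [(1, 3, e1)]"
| "bracket_table (G50 \<alpha> \<beta>) = [(1, 3, e1)]"
| "bracket_table (G51 \<alpha> \<beta>) = [(1, 3, e1)]"
| "bracket_table (G52 \<alpha> \<beta> \<gamma>) = [(1, 3, e1)]"
| "bracket_table (G53 \<alpha> \<beta> \<gamma>) = [(1, 3, e1)]"
| "bracket_table (G54 \<alpha> \<beta> \<gamma>) = [(1, 3, e1)]"
| "bracket_table (G55 \<alpha> \<beta> \<gamma>) = [(1, 3, e1)]"
| "bracket_table (G56 \<alpha> \<beta>) = [(1, 3, e1)]"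
| "bracket_table (G57 \<alpha> \<beta>) = [(1, 3, e1)]"
| "bracket_table (G58 \<alpha> \<beta>) = [(1, 3, e1)]"
| "bracket_table (G59 \<alpha> \<beta>) = [(1, 3, e1)]"
| "bracket_table G60 = [(1, 2, e3), (1, 3, - e2), (2, 3, e1)]"
| "bracket_table G61 = [(1, 2, e3), (1, 3, - e2), (2, 3, e1)]"

primrec mult_table :: "gd_label \<Rightarrow> (3 \<times> 3 \<times> (complex ^ 3)) list" where
  "mult_table (G1 \<alpha>) = [(1, 2, e2 + \<alpha> *s e3), (1, 3, e3)]"
| "mult_table (G2 \<alpha>) = [(1, 1, e3), (1, 2, e1), (2, 1, e1 + \<alpha> *s e3), (2, 2, e2), (2, 3, e3), (3, 2, e3)]"
| "mult_table (G3 \<alpha> \<beta>) = [(1, 1, e1), (1, 2, \<alpha> *s e2 + \<beta> *s e3), (1, 3, \<alpha> *s e3), (2, 1, e2), (3, 1, e3)]"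
| "mult_table (G4 \<alpha>) = [(1, 1, e1 + e2), (1, 2, \<alpha> *s e3), (2, 1, e2), (3, 1, e3)]"
| "mult_table G5 = [(1, 1, e1 + e3), (2, 1, e2), (3, 1, e3)]"
| "mult_table (G6 \<alpha>) = [(1, 2, - (\<alpha> *s e3)), (2, 1, \<alpha> *s e3)]"
| "mult_table G7 = [(1, 1, e1), (1, 2, - e2), (2, 1, e2)]"
| "mult_table (G8 \<alpha> \<beta>) = [(1, 2, \<alpha> *s e3), (2, 1, \<beta> *s e3), (2, 2, e1)]"
| "mult_table G9 = [(2, 2, e2 + e3), (3, 2, e3)]"
| "mult_table G10 = [(2, 2, e2), (3, 2, e3)]"
| "mult_table (G11 \<alpha> \<beta>) = [(1, 1, \<alpha> *s e3), (1, 2, \<beta> *s e3), (2, 2, e3)]"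
| "mult_table (G12 \<alpha>) = [(1, 1, e1), (1, 2, \<alpha> *s e3), (2, 1, e2), (3, 1, e3)]"
| "mult_table (G13 \<alpha> \<beta> \<gamma>) = [(1, 3, \<alpha> *s e1), (2, 3, \<alpha> *s e2), (3, 1, \<beta> *s e2), (3, 2, e1 + \<gamma> *s e2), (3, 3, \<alpha> *s e3)]"
| "mult_table (G14 \<alpha> \<beta>) = [(1, 3, \<alpha> *s e1), (2, 3, \<alpha> *s e2), (3, 2, e1 + \<beta> *s e2), (3, 3, e2 + \<alpha> *s e3)]"
| "mult_table (G15 \<alpha> \<beta>) = [(1, 3, \<alpha> *s e1), (2, 3, \<alpha> *s e2), (3, 2, e1 + \<beta> *s e2), (3, 3, \<alpha> *s e3)]"
| "mult_table (G16 \<alpha> \<beta>) = [(1, 3, \<alpha> *s e1), (2, 3, \<alpha> *s e2), (3, 1, \<beta> *s e1), (3, 2, \<beta> *s e2), (3, 3, \<alpha> *s e3)]"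
| "mult_table (G17 \<alpha>) = [(1, 3, \<alpha> *s e1), (2, 3, \<alpha> *s e2), (3, 3, e1 + \<alpha> *s e3)]"
| "mult_table (G18 \<alpha> \<beta> \<gamma> \<delta>) = [(1, 3, \<beta> *s e1), (2, 3, \<beta> *s e2), (3, 1, \<gamma> *s e1), (3, 2, \<delta> *s e2), (3, 3, \<beta> *s e3)]"
| "mult_table (G19 \<alpha> \<beta> \<gamma> \<delta>) = [(1, 3, \<gamma> *s e1), (2, 3, \<gamma> *s e2), (3, 2, \<delta> *s e2), (3, 3, \<beta> *s e1 + \<gamma> *s e3)]"
| "mult_table (G20 \<alpha> \<beta> \<gamma> \<delta>) = [(1, 3, \<gamma> *s e1), (2, 3, \<gamma> *s e2), (3, 1, \<delta> *s e1), (3, 3, \<beta> *s e2 + \<gamma> *s e3)]"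
| "mult_table (G21 \<alpha> \<beta> \<gamma> \<delta>) = [(1, 3, \<delta> *s e1), (2, 3, \<delta> *s e2), (3, 3, \<beta> *s e1 + \<gamma> *s e2 + \<delta> *s e3)]"
| "mult_table (G22 \<alpha> \<beta> \<gamma>) = [(1, 3, \<gamma> *s e1), (2, 3, e1 + \<gamma> *s e2), (3, 1, - (\<gamma> *s e1)), (3, 2, - ((\<alpha> / (\<alpha> - 1)) *s e1)), (3, 3, \<beta> *s e2 + \<gamma> *s e3)]"
| "mult_table (G23 \<alpha> \<beta> \<gamma>) = [(1, 3, \<gamma> *s e1 + e2), (2, 3, \<gamma> *s e2), (3, 1, (1 / (\<alpha> - 1)) *s e2), (3, 2, - (\<gamma> *s e2)), (3, 3, \<beta> *s e1 + \<gamma> *s e3)]"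
| "mult_table (G24 \<alpha> \<beta>) = [(1, 1, e2), (1, 3, \<alpha> *s e1), (2, 3, \<alpha> *s e2), (3, 1, \<beta> *s e1), (3, 2, (-\<alpha> + 2 * \<beta>) *s e2), (3, 3, \<alpha> *s e3)]"
| "mult_table (G25 \<alpha> \<beta>) = [(1, 1, e2), (1, 3, (2 * \<beta>) *s e1), (2, 3, (2 * \<beta>) *s e2), (3, 1, \<beta> *s e1), (3, 3, \<alpha> *s e2 + (2 * \<beta>) *s e3)]"
| "mult_table (G26 \<alpha> \<beta>) = [(2, 2, e1), (1, 3, \<alpha> *s e1), (2, 3, \<alpha> *s e2), (3, 1, \<beta> *s e1), (3, 2, ((\<alpha> + \<beta>) / 2) *s e2), (3, 3, \<alpha> *s e3)]"
| "mult_table (G27 \<alpha> \<beta>) = [(2, 2, e1), (1, 3, \<beta> *s e1), (2, 3, \<beta> *s e2), (3, 2, (\<beta> / 2) *s e2), (3, 3, \<alpha> *s e1 + \<beta> *s e3)]"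
| "mult_table (G28 \<alpha> \<beta> \<gamma>) = [(1, 3, \<alpha> *s e1), (2, 3, \<alpha> *s e2), (3, 1, \<beta> *s e1), (3, 2, \<gamma> *s e2), (3, 3, \<alpha> *s e3)]"
| "mult_table (G29 \<alpha> \<beta> \<gamma>) = [(1, 3, \<beta> *s e1), (2, 3, \<beta> *s e2), (3, 2, \<gamma> *s e2), (3, 3, \<alpha> *s e1 + \<beta> *s e3)]"
| "mult_table (G30 \<alpha>) = [(1, 3, \<alpha> *s e1), (2, 3, \<alpha> *s e2), (3, 3, \<alpha> *s e3)]"
| "mult_table (G31 \<alpha>) = [(1, 3, \<alpha> *s e1), (2, 3, \<alpha> *s e2), (3, 3, e1 + e2 + \<alpha> *s e3)]"
| "mult_table (G32 \<alpha>) = [(1, 3, \<alpha> *s e1), (2, 3, \<alpha> *s e2), (3, 3, e1 + \<alpha> *s e3)]"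
| "mult_table (G33 \<alpha> \<beta>) = [(1, 3, \<beta> *s e1), (2, 3, e1 + \<beta> *s e2), (3, 1, - (\<beta> *s e1)), (3, 2, - ((1/2) *s e1)), (3, 3, \<alpha> *s e2 + \<beta> *s e3)]"
| "mult_table (G34 \<alpha> \<beta> \<gamma>) = [(1, 3, \<alpha> *s e1), (2, 3, \<alpha> *s e2), (3, 1, \<beta> *s e1 + \<gamma> *s e2), (3, 2, \<beta> *s e2), (3, 3, \<alpha> *s e3)]"
| "mult_table (G35 \<alpha> \<beta> \<gamma>) = [(1, 3, \<beta> *s e1), (2, 3, \<beta> *s e2), (3, 1, \<gamma> *s e2), (3, 3, \<alpha> *s e1 + \<beta> *s e3)]"
| "mult_table (G36 \<alpha>) = [(1, 3, \<alpha> *s e1), (2, 3, \<alpha> *s e2), (3, 3, \<alpha> *s e3)]"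
| "mult_table (G37 \<alpha>) = [(1, 3, \<alpha> *s e1), (2, 3, \<alpha> *s e2), (3, 3, e1 + \<alpha> *s e3)]"
| "mult_table (G38 \<alpha>) = [(1, 3, \<alpha> *s e1), (2, 3, \<alpha> *s e2), (3, 3, e2 + \<alpha> *s e3)]"
| "mult_table (G39 \<alpha>) = [(1, 3, \<alpha> *s e1 + \<alpha> *s e2), (2, 3, \<alpha> *s e2), (3, 2, - (\<alpha> *s e2)), (3, 3, \<alpha> *s e3)]"
| "mult_table (G40 \<alpha>) = [(1, 3, \<alpha> *s e1 + \<alpha> *s e2), (2, 3, \<alpha> *s e2), (3, 2, - (\<alpha> *s e2)), (3, 3, e1 + \<alpha> *s e3)]"
| "mult_table (G41 \<alpha>) = [(1, 2, e1), (2, 1, \<alpha> *s e1), (2, 2, e2), (3, 2, e3)]"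
| "mult_table (G42 \<alpha>) = [(1, 2, e1), (2, 2, e2), (2, 3, \<alpha> *s e1), (3, 2, e3)]"
| "mult_table (G43 \<alpha>) = [(1, 2, e1), (2, 1, - e1), (2, 2, e2), (3, 2, e3), (3, 3, \<alpha> *s e1)]"
| "mult_table G44 = [(1, 3, e2), (3, 1, - e2)]"
| "mult_table (G45 \<alpha>) = [(1, 3, e2), (3, 1, - e2), (3, 3, e1 + \<alpha> *s e2)]"
| "mult_table G46 = [(1, 3, e2), (3, 1, - e2), (3, 3, e2)]"
| "mult_table (G47 \<alpha>) = [(1, 3, \<alpha> *s e1 + e2), (3, 1, - (\<alpha> *s e1) - e2), (3, 3, \<alpha> *s e3)]"
| "mult_table (G48 \<alpha> \<beta>) = [(1, 3, \<beta> *s e1 + e2), (2, 3, \<beta> *s e2), (3, 1, - e2), (3, 2, - (\<beta> *s e2)), (3, 3, \<alpha> *s e1 + \<beta> *s e3)]"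
| "mult_table G49 = [(2, 1, e1)]"
| "mult_table (G50 \<alpha> \<beta>) = [(1, 3, \<alpha> *s e1), (2, 2, e2), (3, 1, \<beta> *s e1), (3, 3, \<alpha> *s e3)]"
| "mult_table (G51 \<alpha> \<beta>) = [(1, 3, \<beta> *s e1), (2, 2, e2), (3, 3, \<alpha> *s e1 + \<beta> *s e3)]"
| "mult_table (G52 \<alpha> \<beta> \<gamma>) = [(1, 3, \<alpha> *s e1), (2, 3, \<alpha> *s e2), (3, 1, \<beta> *s e1), (3, 2, \<gamma> *s e2), (3, 3, \<alpha> *s e3)]"
| "mult_table (G53 \<alpha> \<beta> \<gamma>) = [(1, 3, \<beta> *s e1), (2, 3, \<beta> *s e2), (3, 1, \<gamma> *s e1), (3, 3, \<alpha> *s e2 + \<beta> *s e3)]"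
| "mult_table (G54 \<alpha> \<beta> \<gamma>) = [(1, 3, \<beta> *s e1), (2, 3, \<beta> *s e2), (3, 2, \<gamma> *s e2), (3, 3, \<alpha> *s e1 + \<beta> *s e3)]"
| "mult_table (G55 \<alpha> \<beta> \<gamma>) = [(1, 3, \<gamma> *s e1), (2, 3, \<gamma> *s e2), (3, 3, \<alpha> *s e1 + \<beta> *s e2 + \<gamma> *s e3)]"
| "mult_table (G56 \<alpha> \<beta>) = [(1, 3, \<alpha> *s e1), (3, 1, \<beta> *s e1), (3, 3, \<alpha> *s e3)]"
| "mult_table (G57 \<alpha> \<beta>) = [(1, 3, \<beta> *s e1), (3, 3, \<alpha> *s e1 + \<beta> *s e3)]"
| "mult_table (G58 \<alpha> \<beta>) = [(1, 3, \<beta> *s e1), (2, 3, e1), (3, 3, \<alpha> *s e2 + \<beta> *s e3)]"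
| "mult_table (G59 \<alpha> \<beta>) = [(1, 3, \<beta> *s e1), (2, 3, e1 + \<beta> *s e2), (3, 1, - (\<beta> *s e1)), (3, 3, \<alpha> *s e2 + \<beta> *s e3)]"
| "mult_table G60 = []"
| "mult_table G61 = [(2, 2, - ((1/4) *s e3)), (2, 3, e1), (3, 2, - ((1/2) *s e1))]"

definition gd_mult :: "gd_label \<Rightarrow> (complex, 3) binop" where
  "gd_mult g x y = (\<Sum>(i, j, v)\<leftarrow>mult_table g. (x $ i * y $ j) *s v)"

definition gd_bracket :: "gd_label \<Rightarrow> (complex, 3) binop" where
  "gd_bracket g x y = (\<Sum>(i, j, v)\<leftarrow>bracket_table g. (x $ i * y $ j - x $ j * y $ i) *s v)"

text \<open>
  All pairs \<open>gd_mult g\<close>, \<open>gd_bracket g\<close> with \<open>admissible g\<close> are GD algebras, except that \<open>G61\<close> with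
  the products of the list violates the compatibility identity (at \<open>x = y = e\<^sub>2\<close>, \<open>z = e\<^sub>3\<close>).
  Solvability and nilpotency depend on the two operations only, so that they make sense there as well.
\<close>

lemma not_gd_algebra_G61: "\<not> gd_algebra (gd_mult G61) (gd_bracket G61)"
proof
  let ?m = "gd_mult G61" and ?b = "gd_bracket G61"
  assume "gd_algebra ?m ?b"
  then have "?b e2 (?m e2 e3) - ?b e3 (?m e2 e2) + ?m (?b e2 e2) e3 - ?m (?b e2 e3) e2 - ?m e2 (?b e2 e3) = 0"
    unfolding gd_algebra_def by blast
  then show False
    by (simp add: gd_mult_def gd_bracket_def vec_eq_iff forall_3 axis_def)
qed

end

theory Submission
  imports Defs
begin

text \<open>
  Everything is decided by a few patterns in the tables. Write \<open>A\<close> for the algebra and \<open>R\<^sub>w\<close> for the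
  right multiplication \<open>x \<mapsto> x \<circ> w\<close>.

  Nilpotency fails as soon as some left or right multiplication, by either operation, has an
  eigenvector with a nonzero eigenvalue: such a vector can be multiplied again and again without
  ever vanishing, so it lies in all terms of the lower series (\<open>not_nilpotentI_eigenvector\<close>). Every
  algebra outside of \<open>G6\<close>, \<open>G8\<close>, \<open>G11\<close> has such an eigenvector. In the remaining three, the basis
  vectors can be given positive weights such that both operations at least add the weights
  (\<open>nilpotentI_weights\<close>), and a product of many factors would have a weight that does not occur.

  Solvability fails as soon as \<open>(R\<^sub>w - c)\<^sup>k w = 0\<close> for some \<open>w \<noteq> 0\<close> and \<open>c \<noteq> 0\<close>: the vectors
  \<open>(R\<^sub>w - c)\<^sup>i w\<close> span a subspace that contains \<open>w\<close> and on which \<open>R\<^sub>w\<close> is bijective, so that this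
  subspace survives in every term of the derived series (\<open>not_solvableI_Jordan_chain\<close>). Multiples of
  idempotents are the case \<open>k = 1\<close>. Apart from \<open>G60\<close> and \<open>G61\<close>, whose Lie algebra is perfect, a
  suitable \<open>w\<close> exists in every algebra of the list that is not solvable. The solvable ones have a
  chain of coordinate subspaces, each containing all products of elements of the previous one
  (\<open>solvableI_coordinates\<close>).

  For most of the algebras with a bracket \<open>[e\<^sub>1, e\<^sub>3]\<close> both criteria meet: there
  \<open>A \<circ> A + [A, A]\<close> is contained in \<open>\<langle>e\<^sub>1, e\<^sub>2\<rangle>\<close> up to the coefficient \<open>c\<close> of \<open>e\<^sub>3\<close> in \<open>e\<^sub>3 \<circ> e\<^sub>3\<close>.
  If \<open>c = 0\<close> the algebra is solvable, and otherwise \<open>w = e\<^sub>3\<close> shows that it is not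
  (\<open>solvable_iff_e3\<close>).
\<close>


section \<open>The two series as spans of products\<close>

definition products ::
  "('k::field, 'n::finite) binop \<Rightarrow> ('k, 'n) binop \<Rightarrow> ('k ^ 'n) set \<Rightarrow> ('k ^ 'n) set \<Rightarrow> ('k ^ 'n) set" where
  "products m b U V = {m x y | x y. x \<in> U \<and> y \<in> V} \<union> {b x y | x y. x \<in> U \<and> y \<in> V}"

lemma span_prod_plus_span_prod:
  "span_prod m U V + span_prod b U V = vec.span (products m b U V)"
  unfolding span_prod_def products_def vec.span_Un set_plus_def by auto

lemma sum_span_eq_span_Union:
  fixes X :: "'i \<Rightarrow> ('k::field ^ 'n) set"
  assumes "finite I"
  shows "(\<Sum>i\<in>I. vec.span (X i)) = vec.span (\<Union>i\<in>I. X i)"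
  using assms
proof induction
  case empty
  show ?case by (simp add: set_zero)
next
  case (insert i I)
  then show ?case by (simp add: vec.span_Un set_plus_def) blast
qed

lemma derived_series_Suc:
  "derived_series m b (Suc n) = vec.span (products m b (derived_series m b n) (derived_series m b n))"
  by (simp add: span_prod_plus_span_prod)

lemma lower_series_Suc_Suc:
  "lower_series m b (Suc (Suc n)) =
     vec.span (\<Union>i\<in>{1..Suc n}. products m b (lower_series m b i) (lower_series m b (Suc (Suc n) - i)))"
  by (simp add: span_prod_plus_span_prod sum_span_eq_span_Union del: sum.cl_ivl_Suc)

declare derived_series.simps(2) [simp del] lower_series.simps(3) [simp del]


section \<open>Criteria for nilpotency\<close>

text \<open>
  The coordinate \<open>k\<close> carries the weight \<open>d k\<close>. The assumptions on \<open>m\<close> and \<open>b\<close> say that a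
  coordinate of a product only depends on pairs of coordinates whose weights add up to at most its
  own weight. Hence the vectors supported in weights \<open>\<ge> n\<close> form a multiplicative filtration, which
  contains the lower series and reaches zero beyond the largest weight.
\<close>

lemma nilpotentI_weights:
  fixes m b :: "('k::field, 'n::finite) binop" and d :: "'n \<Rightarrow> nat"
  assumes pos: "\<And>k. d k \<ge> 1"
    and m: "\<And>x y k. \<forall>i j. d i + d j \<le> d k \<longrightarrow> x $ i = 0 \<or> y $ j = 0 \<Longrightarrow> m x y $ k = 0"
    and b: "\<And>x y k. \<forall>i j. d i + d j \<le> d k \<longrightarrow> x $ i = 0 \<or> y $ j = 0 \<Longrightarrow> b x y $ k = 0"
  shows "nilpotent m b"
proof -
  define S where "S n = {x :: 'k ^ 'n. \<forall>k. d k < n \<longrightarrow> x $ k = 0}" for n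
  have sub: "vec.subspace (S n)" for n
    by (auto simp: S_def vec.subspace_def)
  have prod: "products m b (S p) (S q) \<subseteq> S (p + q)" for p q
  proof -
    have "x $ i = 0 \<or> y $ j = 0"
      if "x \<in> S p" "y \<in> S q" "d k < p + q" "d i + d j \<le> d k" for x y i j k
      using that by (cases "d i < p") (auto simp: S_def)
    then show ?thesis
      unfolding products_def S_def [of "p + q"] using m b by blast
  qed
  have lower: "lower_series m b n \<subseteq> S n" for n
  proof (induction n rule: less_induct)
    case (less n)
    show ?case
    proof (cases "n \<le> 1")
      case True
      have "\<not> d k < n" for k
        using pos [of k] True by linarith
      then have "S n = UNIV"
        by (simp add: S_def)
      then show ?thesis by simp
    next
      case False
      then obtain l where n: "n = Suc (Suc l)"
        by (metis One_nat_def le_SucI not0_implies_Suc not_less_eq_eq zero_le)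
      have step: "products m b (lower_series m b i) (lower_series m b (n - i)) \<subseteq> S n"
        if "i \<in> {1..Suc l}" for i
      proof -
        have "products m b (lower_series m b i) (lower_series m b (n - i)) \<subseteq> products m b (S i) (S (n - i))"
          using less.IH [of i] less.IH [of "n - i"] that n unfolding products_def by fastforce
        also have "\<dots> \<subseteq> S n"
          using prod [of i "n - i"] that n by simp
        finally show ?thesis .
      qed
      show ?thesis
        unfolding n lower_series_Suc_Suc
        by (rule vec.span_minimal [OF UN_least sub]) (rule step [unfolded n])
    qed
  qed
  define N where "N = Suc (\<Sum>k\<in>UNIV. d k)"
  have "d k < N" for k
    unfolding N_def by (simp add: le_imp_less_Suc member_le_sum)
  then have "S N = {0}"
    by (auto simp: S_def vec_eq_iff)
  moreover have "0 \<in> lower_series m b N"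
    by (cases N; cases "N - 1") (auto simp: lower_series_Suc_Suc vec.span_zero)
  ultimately have "lower_series m b N = {0}"
    using lower [of N] by blast
  then show ?thesis
    unfolding nilpotent_def by (intro exI [of _ N]) (simp add: N_def)
qed

text \<open>
  An eigenvector lies in \<open>lower_series m b (Suc n)\<close> as a multiple of a product of \<open>u\<close>, which lies in
  the first term of the series, and of itself, which lies in the \<open>n\<close>-th term.
\<close>

lemma not_nilpotentI_eigenvector:
  assumes "c \<noteq> 0" "v \<noteq> 0" "c *s v \<in> {m u v, m v u, b u v}"
  shows "\<not> nilpotent m b"
proof -
  have "v \<in> lower_series m b (Suc n)" for n
  proof (induction n)
    case (Suc n)
    let ?P = "\<lambda>i. products m b (lower_series m b i) (lower_series m b (Suc (Suc n) - i))"
    have "c *s v \<in> products m b UNIV (lower_series m b (Suc n)) \<union> products m b (lower_series m b (Suc n)) UNIV"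
      using assms(3) Suc.IH unfolding products_def by blast
    also have "\<dots> \<subseteq> (\<Union>i\<in>{1..Suc n}. ?P i)"
      using UN_upper [of 1 "{1..Suc n}" ?P] UN_upper [of "Suc n" "{1..Suc n}" ?P] by simp
    finally have "c *s v \<in> lower_series m b (Suc (Suc n))"
      unfolding lower_series_Suc_Suc by (rule vec.span_base)
    then have "inverse c *s (c *s v) \<in> lower_series m b (Suc (Suc n))"
      unfolding lower_series_Suc_Suc by (rule vec.span_scale)
    then show ?case
      using assms(1) by simp
  qed simp
  then show ?thesis
    using assms(2) unfolding nilpotent_def
    by (metis One_nat_def Suc_le_D singletonD)
qed


section \<open>Criteria for solvability\<close>

lemma solvableI_chain:
  assumes "S 0 = UNIV" "S N = {0}" "\<And>n. vec.subspace (S n)"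
    and "\<And>n x y. x \<in> S n \<Longrightarrow> y \<in> S n \<Longrightarrow> m x y \<in> S (Suc n) \<and> b x y \<in> S (Suc n)"
  shows "solvable m b"
proof -
  have "derived_series m b n \<subseteq> S n" for n
  proof (induction n)
    case (Suc n)
    then have "products m b (derived_series m b n) (derived_series m b n) \<subseteq> S (Suc n)"
      using assms(4) [of _ n] unfolding products_def by blast
    then show ?case
      unfolding derived_series_Suc using assms(3) by (rule vec.span_minimal)
  qed (simp add: assms(1))
  moreover have "0 \<in> derived_series m b N"
    by (cases N) (auto simp: derived_series_Suc vec.span_zero)
  ultimately show ?thesis
    using assms(2) unfolding solvable_def by blast
qed

text \<open>
  The special case of a chain of length three that is cut out by coordinates. With \<open>i = j\<close> it becomes
  the case of length two, in which all products of vectors with \<open>x $ i = 0\<close> vanish.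
\<close>

lemma solvableI_coordinates:
  fixes m b :: "('k::field, 'n::finite) binop"
  assumes "\<And>x y. m x y $ i = 0 \<and> b x y $ i = 0"
    and "\<And>x y. x $ i = 0 \<Longrightarrow> y $ i = 0 \<Longrightarrow> m x y $ j = 0 \<and> b x y $ j = 0"
    and "\<And>x y. x $ i = 0 \<Longrightarrow> y $ i = 0 \<Longrightarrow> x $ j = 0 \<Longrightarrow> y $ j = 0 \<Longrightarrow> m x y = 0 \<and> b x y = 0"
  shows "solvable m b"
proof (rule solvableI_chain)
  let ?S = "\<lambda>n :: nat. {x :: 'k ^ 'n. (n \<ge> 1 \<longrightarrow> x $ i = 0) \<and> (n \<ge> 2 \<longrightarrow> x $ j = 0) \<and> (n \<ge> 3 \<longrightarrow> x = 0)}"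
  show "?S 0 = UNIV" "?S 3 = {0}" by auto
  show "vec.subspace (?S n)" for n by (auto simp: vec.subspace_def)
  show "m x y \<in> ?S (Suc n) \<and> b x y \<in> ?S (Suc n)" if "x \<in> ?S n" "y \<in> ?S n" for n x y
    using that assms by simp
qed

text \<open>
  With \<open>r x = x \<circ> w - c x\<close>, the identity \<open>r\<^sup>i w = c\<^sup>-\<^sup>1 (r\<^sup>i w \<circ> w - r\<^sup>i\<^sup>+\<^sup>1 w)\<close> recovers each vector of the
  chain from a product of two chain vectors and the next chain vector. Since the chain ends with
  \<open>r\<^sup>k w = 0\<close>, a downward induction on \<open>i\<close> carries the whole chain from one term of the derived
  series to the next.
\<close>

lemma not_solvableI_Jordan_chain:
  assumes "c \<noteq> 0" "w \<noteq> 0" "((\<lambda>x. m x w - c *s x) ^^ k) w = 0"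
  shows "\<not> solvable m b"
proof -
  define r where "r x = m x w - c *s x" for x
  have chain: "\<forall>i\<le>k. (r ^^ i) w \<in> derived_series m b n" for n
  proof (induction n)
    case (Suc n)
    show ?case
    proof (intro allI impI)
      fix i assume "i \<le> k"
      then show "(r ^^ i) w \<in> derived_series m b (Suc n)"
      proof (induction i rule: inc_induct)
        case base
        then show ?case
          using assms(3) unfolding r_def derived_series_Suc by (simp add: vec.span_zero)
      next
        case (step i)
        let ?x = "(r ^^ i) w"
        have "m ?x w \<in> derived_series m b (Suc n)"
          unfolding derived_series_Suc products_def
          using Suc.IH step.hyps by (intro vec.span_base UnI1 CollectI exI [of _ ?x] exI [of _ w])
            (auto dest: spec [of _ 0])
        then have "inverse c *s (m ?x w - (r ^^ Suc i) w) \<in> derived_series m b (Suc n)"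
          using step.IH unfolding derived_series_Suc by (intro vec.span_scale vec.span_diff)
        then show ?case
          using assms(1) by (simp add: r_def [of ?x])
      qed
    qed
  qed simp
  have "w \<in> derived_series m b n" for n
    using chain [of n] by (auto dest: spec [of _ 0])
  then show ?thesis
    using assms(2) unfolding solvable_def by auto
qed

lemma not_solvableI_perfect:
  assumes "X \<subseteq> vec.span (products m b X X)" "x \<in> X" "x \<noteq> 0"
  shows "\<not> solvable m b"
proof -
  have "X \<subseteq> derived_series m b n" for n
  proof (induction n)
    case (Suc n)
    then have "products m b X X \<subseteq> products m b (derived_series m b n) (derived_series m b n)"
      unfolding products_def by blast
    then show ?case
      unfolding derived_series_Suc using assms(1) vec.span_mono by blast
  qed simp
  then show ?thesis
    using assms(2,3) unfolding solvable_def by blast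
qed

text \<open>
  The shape shared by almost all algebras in which \<open>e\<^sub>3\<close> acts on \<open>\<langle>e\<^sub>1, e\<^sub>2\<rangle>\<close>. In the tables,
  right multiplication by \<open>e\<^sub>3\<close> maps \<open>e\<^sub>3\<close>, and each basis vector reached from it, to its multiple by \<open>c\<close>
  plus basis vectors further down, which is why \<open>R\<^sub>w - c\<close> with \<open>w = e\<^sub>3\<close> kills \<open>e\<^sub>3\<close> after three steps. The index \<open>j\<close> only matters when \<open>\<langle>e\<^sub>1, e\<^sub>2\<rangle>\<close> has
  nonzero products; otherwise \<open>j = 3\<close> makes the corresponding assumptions trivial.
\<close>

lemma solvable_iff_e3:
  fixes m b :: "(complex, 3) binop"
  assumes "\<And>x y. m x y $ 3 = c * (x $ 3 * y $ 3) \<and> b x y $ 3 = 0"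
    and "\<And>x y. x $ 3 = 0 \<Longrightarrow> y $ 3 = 0 \<Longrightarrow> m x y $ j = 0 \<and> b x y = 0"
    and "\<And>x y. x $ 3 = 0 \<Longrightarrow> y $ 3 = 0 \<Longrightarrow> x $ j = 0 \<Longrightarrow> y $ j = 0 \<Longrightarrow> m x y = 0"
    and "((\<lambda>x. m x e3 - c *s x) ^^ 3) e3 = 0"
  shows "solvable m b \<longleftrightarrow> c = 0"
proof
  assume "c = 0"
  with assms show "solvable m b"
    by (intro solvableI_coordinates [where i = 3 and j = j]) auto
next
  assume "solvable m b"
  with assms(4) not_solvableI_Jordan_chain [where c = c and w = e3 and m = m and k = 3 and b = b]
  show "c = 0" by auto
qed

text \<open>The cross product bracket, which is perfect.\<close>

lemma not_solvable_cross_product: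
  assumes "b e1 e2 = e3" "b e2 e3 = e1" "b e1 e3 = - e2"
  shows "\<not> solvable m b"
proof (rule not_solvableI_perfect [where x = e1])
  let ?E = "{e1, e2, e3}"
  have *: "b e1 e2 \<in> products m b ?E ?E" "b e2 e3 \<in> products m b ?E ?E" "b e1 e3 \<in> products m b ?E ?E"
    unfolding products_def by blast+
  then have "- b e1 e3 \<in> vec.span (products m b ?E ?E)"
    by (intro vec.span_neg vec.span_base)
  with * show "?E \<subseteq> vec.span (products m b ?E ?E)"
    by (auto simp: assms intro: vec.span_base)
qed auto


section \<open>Nilpotency in the list\<close>

lemmas table_simps = gd_mult_def gd_bracket_def vec_eq_iff forall_3 axis_def

lemma table_sum_component_eq_0:
  fixes f :: "'i \<Rightarrow> 'j \<Rightarrow> 'k::field"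
  assumes "\<And>i j v. (i, j, v) \<in> set xs \<Longrightarrow> f i j = 0 \<or> v $ k = 0"
  shows "(\<Sum>(i, j, v)\<leftarrow>xs. f i j *s v) $ k = 0"
  using assms by (induction xs) auto

lemma nilpotent_gd_weights:
  fixes d :: "3 \<Rightarrow> nat"
  assumes pos: "\<And>k. d k \<ge> 1"
    and table: "\<forall>(i, j, v) \<in> set (mult_table g) \<union> set (bracket_table g).
      \<forall>k. v $ k \<noteq> 0 \<longrightarrow> d i + d j \<le> d k"
  shows "nilpotent (gd_mult g) (gd_bracket g)"
proof (rule nilpotentI_weights [of d, OF pos])
  fix x y :: "complex ^ 3" and k
  assume zero: "\<forall>i j. d i + d j \<le> d k \<longrightarrow> x $ i = 0 \<or> y $ j = 0"
  show "gd_mult g x y $ k = 0"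
    unfolding gd_mult_def
  proof (rule table_sum_component_eq_0)
    fix i j v assume "(i, j, v) \<in> set (mult_table g)"
    with table zero show "x $ i * y $ j = 0 \<or> v $ k = 0"
      by fastforce
  qed
  show "gd_bracket g x y $ k = 0"
    unfolding gd_bracket_def
  proof (rule table_sum_component_eq_0)
    fix i j v assume "(i, j, v) \<in> set (bracket_table g)"
    with table have "d i + d j \<le> d k" "d j + d i \<le> d k" if "v $ k \<noteq> 0"
      using that by (fastforce simp: add.commute)+
    with zero have "x $ i * y $ j = 0" "x $ j * y $ i = 0" if "v $ k \<noteq> 0"
      using that by simp_all
    then show "x $ i * y $ j - x $ j * y $ i = 0 \<or> v $ k = 0"
      by (metis diff_zero)
  qed
qed

text \<open>
  The complex eigenvector \<open>e\<^sub>2 + \<i> e\<^sub>3\<close> serves \<open>G60\<close> and \<open>G61\<close>, where \<open>[e\<^sub>1, -]\<close> rotates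
  \<open>\<langle>e\<^sub>2, e\<^sub>3\<rangle>\<close> by a right angle.
\<close>

lemma gd_bracket_or_mult_eigenvector:
  "(\<exists>\<alpha>. g = G6 \<alpha>) \<or> (\<exists>\<alpha> \<beta>. g = G8 \<alpha> \<beta>) \<or> (\<exists>\<alpha> \<beta>. g = G11 \<alpha> \<beta>) \<or>
   gd_bracket g e3 e1 = - e1 \<or> gd_bracket g e3 e2 = - e2 \<or>
   gd_bracket g e1 (e2 + \<i> *s e3) = - \<i> *s (e2 + \<i> *s e3) \<or>
   gd_mult g e1 e3 = e3 \<or> gd_mult g e3 e2 = e3 \<or> gd_mult g e3 e1 = e3 \<or> gd_mult g e1 e1 = e1"
  by (cases g; simp add: table_simps)

lemma nilpotent_gd_iff:
  "nilpotent (gd_mult g) (gd_bracket g) \<longleftrightarrow>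
     (\<exists>\<alpha>. g = G6 \<alpha>) \<or> (\<exists>\<alpha> \<beta>. g = G8 \<alpha> \<beta>) \<or> (\<exists>\<alpha> \<beta>. g = G11 \<alpha> \<beta>)"
  (is "?nil \<longleftrightarrow> ?list")
proof
  assume ?list
  then consider (G6_G11) "(\<exists>\<alpha>. g = G6 \<alpha>) \<or> (\<exists>\<alpha> \<beta>. g = G11 \<alpha> \<beta>)" | (G8) "\<exists>\<alpha> \<beta>. g = G8 \<alpha> \<beta>"
    by blast
  then show ?nil
  proof cases
    case G6_G11
    then show ?thesis
      by (intro nilpotent_gd_weights [of "\<lambda>k. if k = 3 then 2 else 1"])
        (elim disjE exE; simp add: forall_3 axis_def)+
  next
    case G8
    \<comment> \<open>The algebra is generated by \<open>e\<^sub>2\<close>: the vector \<open>e\<^sub>1\<close> is \<open>e\<^sub>2 \<circ> e\<^sub>2\<close>, and \<open>e\<^sub>3\<close> is \<open>[e\<^sub>1, e\<^sub>2]\<close>.\<close>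
    then show ?thesis
      by (intro nilpotent_gd_weights [of "\<lambda>k. if k = 2 then 1 else if k = 1 then 2 else 3"])
        (elim exE; simp add: forall_3 axis_def)+
  qed
next
  assume nil: ?nil
  note not_eigen = not_nilpotentI_eigenvector [where m = "gd_mult g" and b = "gd_bracket g"]
  show ?list
  proof (rule ccontr)
    assume "\<not> ?list"
    then consider "gd_bracket g e3 e1 = - e1" | "gd_bracket g e3 e2 = - e2"
      | "gd_bracket g e1 (e2 + \<i> *s e3) = - \<i> *s (e2 + \<i> *s e3)"
      | "gd_mult g e1 e3 = e3" | "gd_mult g e3 e2 = e3" | "gd_mult g e3 e1 = e3" | "gd_mult g e1 e1 = e1"
      using gd_bracket_or_mult_eigenvector [of g] by blast
    then show False
    proof cases
      case 1
      then show ?thesis using not_eigen [where c = "-1" and v = e1 and u = e3] nil by simp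
    next
      case 2
      then show ?thesis using not_eigen [where c = "-1" and v = e2 and u = e3] nil by simp
    next
      case 3
      moreover have "e2 + \<i> *s e3 \<noteq> 0"
        by (simp add: table_simps)
      ultimately show ?thesis
        using not_eigen [where c = "- \<i>" and v = "e2 + \<i> *s e3"] nil
        by (metis (no_types, lifting) insertCI neg_equal_0_iff_equal complex_i_not_zero)
    next
      case 4
      then show ?thesis using not_eigen [where c = 1 and v = e3 and u = e1] nil by simp
    next
      case 5
      then show ?thesis using not_eigen [where c = 1 and v = e3 and u = e2] nil by simp
    next
      case 6
      then show ?thesis using not_eigen [where c = 1 and v = e3 and u = e1] nil by simp
    next
      case 7
      then show ?thesis using not_eigen [where c = 1 and v = e1 and u = e1] nil by simp
    qed
  qed
qed


section \<open>Solvability in the list\<close>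

text \<open>
  In \<open>G1\<close> and \<open>G6\<close> the first coordinate vanishes on all products, and \<open>\<langle>e\<^sub>2, e\<^sub>3\<rangle>\<close> has zero
  products. In \<open>G8\<close> and \<open>G11\<close> the second coordinate vanishes on all products, and what
  \<open>\<langle>e\<^sub>1, e\<^sub>3\<rangle>\<close> produces is a multiple of \<open>e\<^sub>3\<close>, which annihilates itself.
\<close>

lemma solvable_Heisenberg_bracket:
  shows "solvable (gd_mult (G1 \<alpha>)) (gd_bracket (G1 \<alpha>))"
    and "solvable (gd_mult (G6 \<alpha>)) (gd_bracket (G6 \<alpha>))"
    and "solvable (gd_mult (G8 \<alpha> \<beta>)) (gd_bracket (G8 \<alpha> \<beta>))"
    and "solvable (gd_mult (G11 \<alpha> \<beta>)) (gd_bracket (G11 \<alpha> \<beta>))"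
  by (rule solvableI_coordinates [where i = 1 and j = 1] solvableI_coordinates [where i = 2 and j = 1];
      simp add: table_simps)+

lemma not_solvable_Jordan_chain_e1:
  shows "\<not> solvable (gd_mult (G3 \<alpha> \<beta>)) (gd_bracket (G3 \<alpha> \<beta>))"
    and "\<not> solvable (gd_mult (G4 \<alpha>)) (gd_bracket (G4 \<alpha>))"
    and "\<not> solvable (gd_mult G5) (gd_bracket G5)"
    and "\<not> solvable (gd_mult G7) (gd_bracket G7)"
    and "\<not> solvable (gd_mult (G12 \<alpha>)) (gd_bracket (G12 \<alpha>))"
  by (rule not_solvableI_Jordan_chain [where c = 1 and w = e1 and k = 3];
      simp add: table_simps numeral_3_eq_3)+

lemma not_solvable_Jordan_chain_e2:
  shows "\<not> solvable (gd_mult (G2 \<alpha>)) (gd_bracket (G2 \<alpha>))"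
    and "\<not> solvable (gd_mult G9) (gd_bracket G9)"
    and "\<not> solvable (gd_mult G10) (gd_bracket G10)"
    and "\<not> solvable (gd_mult (G41 \<alpha>)) (gd_bracket (G41 \<alpha>))"
    and "\<not> solvable (gd_mult (G42 \<alpha>)) (gd_bracket (G42 \<alpha>))"
    and "\<not> solvable (gd_mult (G43 \<alpha>)) (gd_bracket (G43 \<alpha>))"
    and "\<not> solvable (gd_mult (G50 \<alpha> \<beta>)) (gd_bracket (G50 \<alpha> \<beta>))"
    and "\<not> solvable (gd_mult (G51 \<alpha> \<beta>)) (gd_bracket (G51 \<alpha> \<beta>))"
  by (rule not_solvableI_Jordan_chain [where c = 1 and w = e2 and k = 3];
      simp add: table_simps numeral_3_eq_3)+

lemma solvable_iff_e3_coefficient: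
  shows "solvable (gd_mult (G13 \<alpha> \<beta> \<gamma>)) (gd_bracket (G13 \<alpha> \<beta> \<gamma>)) \<longleftrightarrow> \<alpha> = 0"
    and "solvable (gd_mult (G14 \<alpha> \<beta>)) (gd_bracket (G14 \<alpha> \<beta>)) \<longleftrightarrow> \<alpha> = 0"
    and "solvable (gd_mult (G15 \<alpha> \<beta>)) (gd_bracket (G15 \<alpha> \<beta>)) \<longleftrightarrow> \<alpha> = 0"
    and "solvable (gd_mult (G16 \<alpha> \<beta>)) (gd_bracket (G16 \<alpha> \<beta>)) \<longleftrightarrow> \<alpha> = 0"
    and "solvable (gd_mult (G17 \<alpha>)) (gd_bracket (G17 \<alpha>)) \<longleftrightarrow> \<alpha> = 0"
    and "solvable (gd_mult (G18 \<alpha> \<beta> \<gamma> \<delta>)) (gd_bracket (G18 \<alpha> \<beta> \<gamma> \<delta>)) \<longleftrightarrow> \<beta> = 0"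
    and "solvable (gd_mult (G19 \<alpha> \<beta> \<gamma> \<delta>)) (gd_bracket (G19 \<alpha> \<beta> \<gamma> \<delta>)) \<longleftrightarrow> \<gamma> = 0"
    and "solvable (gd_mult (G20 \<alpha> \<beta> \<gamma> \<delta>)) (gd_bracket (G20 \<alpha> \<beta> \<gamma> \<delta>)) \<longleftrightarrow> \<gamma> = 0"
    and "solvable (gd_mult (G21 \<alpha> \<beta> \<gamma> \<delta>)) (gd_bracket (G21 \<alpha> \<beta> \<gamma> \<delta>)) \<longleftrightarrow> \<delta> = 0"
    and "solvable (gd_mult (G22 \<alpha> \<beta> \<gamma>)) (gd_bracket (G22 \<alpha> \<beta> \<gamma>)) \<longleftrightarrow> \<gamma> = 0"
    and "solvable (gd_mult (G23 \<alpha> \<beta> \<gamma>)) (gd_bracket (G23 \<alpha> \<beta> \<gamma>)) \<longleftrightarrow> \<gamma> = 0"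
    and "solvable (gd_mult (G28 \<alpha> \<beta> \<gamma>)) (gd_bracket (G28 \<alpha> \<beta> \<gamma>)) \<longleftrightarrow> \<alpha> = 0"
    and "solvable (gd_mult (G29 \<alpha> \<beta> \<gamma>)) (gd_bracket (G29 \<alpha> \<beta> \<gamma>)) \<longleftrightarrow> \<beta> = 0"
    and "solvable (gd_mult (G30 \<alpha>)) (gd_bracket (G30 \<alpha>)) \<longleftrightarrow> \<alpha> = 0"
    and "solvable (gd_mult (G31 \<alpha>)) (gd_bracket (G31 \<alpha>)) \<longleftrightarrow> \<alpha> = 0"
    and "solvable (gd_mult (G32 \<alpha>)) (gd_bracket (G32 \<alpha>)) \<longleftrightarrow> \<alpha> = 0"
    and "solvable (gd_mult (G33 \<alpha> \<beta>)) (gd_bracket (G33 \<alpha> \<beta>)) \<longleftrightarrow> \<beta> = 0"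
    and "solvable (gd_mult (G34 \<alpha> \<beta> \<gamma>)) (gd_bracket (G34 \<alpha> \<beta> \<gamma>)) \<longleftrightarrow> \<alpha> = 0"
    and "solvable (gd_mult (G35 \<alpha> \<beta> \<gamma>)) (gd_bracket (G35 \<alpha> \<beta> \<gamma>)) \<longleftrightarrow> \<beta> = 0"
    and "solvable (gd_mult (G36 \<alpha>)) (gd_bracket (G36 \<alpha>)) \<longleftrightarrow> \<alpha> = 0"
    and "solvable (gd_mult (G37 \<alpha>)) (gd_bracket (G37 \<alpha>)) \<longleftrightarrow> \<alpha> = 0"
    and "solvable (gd_mult (G38 \<alpha>)) (gd_bracket (G38 \<alpha>)) \<longleftrightarrow> \<alpha> = 0"
    and "solvable (gd_mult (G39 \<alpha>)) (gd_bracket (G39 \<alpha>)) \<longleftrightarrow> \<alpha> = 0"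
    and "solvable (gd_mult (G40 \<alpha>)) (gd_bracket (G40 \<alpha>)) \<longleftrightarrow> \<alpha> = 0"
    and "solvable (gd_mult (G47 \<alpha>)) (gd_bracket (G47 \<alpha>)) \<longleftrightarrow> \<alpha> = 0"
    and "solvable (gd_mult (G48 \<alpha> \<beta>)) (gd_bracket (G48 \<alpha> \<beta>)) \<longleftrightarrow> \<beta> = 0"
    and "solvable (gd_mult (G52 \<alpha> \<beta> \<gamma>)) (gd_bracket (G52 \<alpha> \<beta> \<gamma>)) \<longleftrightarrow> \<alpha> = 0"
    and "solvable (gd_mult (G53 \<alpha> \<beta> \<gamma>)) (gd_bracket (G53 \<alpha> \<beta> \<gamma>)) \<longleftrightarrow> \<beta> = 0"
    and "solvable (gd_mult (G54 \<alpha> \<beta> \<gamma>)) (gd_bracket (G54 \<alpha> \<beta> \<gamma>)) \<longleftrightarrow> \<beta> = 0"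
    and "solvable (gd_mult (G55 \<alpha> \<beta> \<gamma>)) (gd_bracket (G55 \<alpha> \<beta> \<gamma>)) \<longleftrightarrow> \<gamma> = 0"
    and "solvable (gd_mult (G56 \<alpha> \<beta>)) (gd_bracket (G56 \<alpha> \<beta>)) \<longleftrightarrow> \<alpha> = 0"
    and "solvable (gd_mult (G57 \<alpha> \<beta>)) (gd_bracket (G57 \<alpha> \<beta>)) \<longleftrightarrow> \<beta> = 0"
    and "solvable (gd_mult (G59 \<alpha> \<beta>)) (gd_bracket (G59 \<alpha> \<beta>)) \<longleftrightarrow> \<beta> = 0"
  by (rule solvable_iff_e3 [where j = 3]; simp add: table_simps numeral_3_eq_3 algebra_simps)+

text \<open>
  Here \<open>\<langle>e\<^sub>1, e\<^sub>2\<rangle>\<close> has a nonzero square, spanned by \<open>e\<^sub>2\<close> in the first two algebras and by \<open>e\<^sub>1\<close> in the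
  other two.
\<close>

lemma solvable_iff_e3_coefficient_nonzero_square:
  shows "solvable (gd_mult (G24 \<alpha> \<beta>)) (gd_bracket (G24 \<alpha> \<beta>)) \<longleftrightarrow> \<alpha> = 0"
    and "solvable (gd_mult (G25 \<alpha> \<beta>)) (gd_bracket (G25 \<alpha> \<beta>)) \<longleftrightarrow> 2 * \<beta> = 0"
    and "solvable (gd_mult (G26 \<alpha> \<beta>)) (gd_bracket (G26 \<alpha> \<beta>)) \<longleftrightarrow> \<alpha> = 0"
    and "solvable (gd_mult (G27 \<alpha> \<beta>)) (gd_bracket (G27 \<alpha> \<beta>)) \<longleftrightarrow> \<beta> = 0"
  by (rule solvable_iff_e3 [where j = 1] solvable_iff_e3 [where j = 2];
      simp add: table_simps numeral_3_eq_3 algebra_simps)+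

lemma solvable_no_e3_component:
  shows "solvable (gd_mult G44) (gd_bracket G44)"
    and "solvable (gd_mult (G45 \<alpha>)) (gd_bracket (G45 \<alpha>))"
    and "solvable (gd_mult G46) (gd_bracket G46)"
    and "solvable (gd_mult G49) (gd_bracket G49)"
  by (rule solvableI_coordinates [where i = 3 and j = 2]; simp add: table_simps)+

text \<open>
  For \<open>\<alpha> \<noteq> 0\<close>, \<open>e\<^sub>3\<close> is not a suitable \<open>w\<close>, since \<open>e\<^sub>3 \<circ> e\<^sub>3\<close> involves \<open>e\<^sub>2\<close> and \<open>e\<^sub>2 \<circ> e\<^sub>3 = e\<^sub>1\<close> has no component along \<open>e\<^sub>2\<close>. But
  \<open>w = e\<^sub>3 \<circ> e\<^sub>3\<close> satisfies \<open>w \<circ> w = \<beta>\<^sup>2 w + \<alpha> \<beta> e\<^sub>1\<close> and \<open>e\<^sub>1 \<circ> w = \<beta>\<^sup>2 e\<^sub>1\<close>.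
\<close>

lemma solvable_G58_iff: "solvable (gd_mult (G58 \<alpha> \<beta>)) (gd_bracket (G58 \<alpha> \<beta>)) \<longleftrightarrow> \<beta> = 0"
proof (cases "\<beta> = 0")
  case True
  have "solvable (gd_mult (G58 \<alpha> 0)) (gd_bracket (G58 \<alpha> 0))"
    by (rule solvableI_coordinates [where i = 3 and j = 3]; simp add: table_simps)
  with True show ?thesis by simp
next
  case False
  have "\<not> solvable (gd_mult (G58 \<alpha> \<beta>)) (gd_bracket (G58 \<alpha> \<beta>))"
    by (rule not_solvableI_Jordan_chain
          [where c = "\<beta>\<^sup>2" and w = "\<alpha> *s e2 + \<beta> *s e3" and k = 3])
      (simp_all add: False table_simps numeral_3_eq_3 algebra_simps power2_eq_square)
  with False show ?thesis by simp
qed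

lemma not_solvable_cross_product_bracket:
  shows "\<not> solvable (gd_mult G60) (gd_bracket G60)"
    and "\<not> solvable (gd_mult G61) (gd_bracket G61)"
  by (rule not_solvable_cross_product; simp add: table_simps)+

text \<open>
  The restrictions on the parameters matter in \<open>G39\<close>, \<open>G40\<close>, \<open>G47\<close>, \<open>G48\<close>, \<open>G56\<close>, \<open>G57\<close> and \<open>G59\<close>,
  where they make the coefficient of \<open>e\<^sub>3\<close> in \<open>e\<^sub>3 \<circ> e\<^sub>3\<close> nonzero.
\<close>

lemma solvable_gd_iff:
  assumes "admissible g"
  shows "solvable (gd_mult g) (gd_bracket g) \<longleftrightarrow>
        ((\<exists>\<alpha>. g = G1 \<alpha>) \<or>
         (\<exists>\<alpha>. g = G6 \<alpha>) \<or>
         (\<exists>\<alpha> \<beta>. g = G8 \<alpha> \<beta>) \<or>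
         (\<exists>\<alpha> \<beta>. g = G11 \<alpha> \<beta>) \<or>
         (\<exists>\<beta> \<gamma>. g = G13 0 \<beta> \<gamma>) \<or>
         (\<exists>\<beta>. g = G14 0 \<beta>) \<or>
         (\<exists>\<beta>. g = G15 0 \<beta>) \<or>
         (\<exists>\<beta>. g = G16 0 \<beta>) \<or>
         g = G17 0 \<or>
         (\<exists>\<alpha> \<gamma> \<delta>. g = G18 \<alpha> 0 \<gamma> \<delta>) \<or>
         (\<exists>\<alpha> \<beta> \<delta>. g = G19 \<alpha> \<beta> 0 \<delta>) \<or>
         (\<exists>\<alpha> \<beta> \<delta>. g = G20 \<alpha> \<beta> 0 \<delta>) \<or>
         (\<exists>\<alpha> \<beta> \<gamma>. g = G21 \<alpha> \<beta> \<gamma> 0) \<or>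
         (\<exists>\<alpha> \<beta>. g = G22 \<alpha> \<beta> 0) \<or>
         (\<exists>\<alpha> \<beta>. g = G23 \<alpha> \<beta> 0) \<or>
         (\<exists>\<beta>. g = G24 0 \<beta>) \<or>
         (\<exists>\<alpha>. g = G25 \<alpha> 0) \<or>
         (\<exists>\<beta>. g = G26 0 \<beta>) \<or>
         (\<exists>\<alpha>. g = G27 \<alpha> 0) \<or>
         (\<exists>\<beta> \<gamma>. g = G28 0 \<beta> \<gamma>) \<or>
         (\<exists>\<alpha> \<gamma>. g = G29 \<alpha> 0 \<gamma>) \<or>
         g = G30 0 \<or>
         g = G31 0 \<or>
         g = G32 0 \<or>
         (\<exists>\<alpha>. g = G33 \<alpha> 0) \<or>
         (\<exists>\<beta> \<gamma>. g = G34 0 \<beta> \<gamma>) \<or>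
         (\<exists>\<alpha> \<gamma>. g = G35 \<alpha> 0 \<gamma>) \<or>
         g = G36 0 \<or>
         g = G37 0 \<or>
         g = G38 0 \<or>
         g = G44 \<or>
         (\<exists>\<alpha>. g = G45 \<alpha>) \<or>
         g = G46 \<or>
         g = G49 \<or>
         (\<exists>\<beta> \<gamma>. g = G52 0 \<beta> \<gamma>) \<or>
         (\<exists>\<alpha> \<gamma>. g = G53 \<alpha> 0 \<gamma>) \<or>
         (\<exists>\<alpha> \<gamma>. g = G54 \<alpha> 0 \<gamma>) \<or>
         (\<exists>\<alpha> \<beta>. g = G55 \<alpha> \<beta> 0) \<or>
         (\<exists>\<alpha>. g = G58 \<alpha> 0))"
  using assms
  by (cases g)
    (simp_all add: solvable_Heisenberg_bracket not_solvable_Jordan_chain_e1 not_solvable_Jordan_chain_e2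
      solvable_iff_e3_coefficient solvable_iff_e3_coefficient_nonzero_square solvable_no_e3_component
      solvable_G58_iff not_solvable_cross_product_bracket)

theorem proposition7p14:
  fixes g :: gd_label
  assumes "admissible g"
  shows "(nilpotent (gd_mult g) (gd_bracket g) \<longleftrightarrow>
        ((\<exists>\<alpha>. g = G6 \<alpha>) \<or>
         (\<exists>\<alpha> \<beta>. g = G8 \<alpha> \<beta>) \<or>
         (\<exists>\<alpha> \<beta>. g = G11 \<alpha> \<beta>))) \<and>
     (solvable (gd_mult g) (gd_bracket g) \<longleftrightarrow>
        ((\<exists>\<alpha>. g = G1 \<alpha>) \<or>
         (\<exists>\<alpha>. g = G6 \<alpha>) \<or>
         (\<exists>\<alpha> \<beta>. g = G8 \<alpha> \<beta>) \<or>
         (\<exists>\<alpha> \<beta>. g = G11 \<alpha> \<beta>) \<or>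
         (\<exists>\<beta> \<gamma>. g = G13 0 \<beta> \<gamma>) \<or>
         (\<exists>\<beta>. g = G14 0 \<beta>) \<or>
         (\<exists>\<beta>. g = G15 0 \<beta>) \<or>
         (\<exists>\<beta>. g = G16 0 \<beta>) \<or>
         g = G17 0 \<or>
         (\<exists>\<alpha> \<gamma> \<delta>. g = G18 \<alpha> 0 \<gamma> \<delta>) \<or>
         (\<exists>\<alpha> \<beta> \<delta>. g = G19 \<alpha> \<beta> 0 \<delta>) \<or>
         (\<exists>\<alpha> \<beta> \<delta>. g = G20 \<alpha> \<beta> 0 \<delta>) \<or>
         (\<exists>\<alpha> \<beta> \<gamma>. g = G21 \<alpha> \<beta> \<gamma> 0) \<or>
         (\<exists>\<alpha> \<beta>. g = G22 \<alpha> \<beta> 0) \<or>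
         (\<exists>\<alpha> \<beta>. g = G23 \<alpha> \<beta> 0) \<or>
         (\<exists>\<beta>. g = G24 0 \<beta>) \<or>
         (\<exists>\<alpha>. g = G25 \<alpha> 0) \<or>
         (\<exists>\<beta>. g = G26 0 \<beta>) \<or>
         (\<exists>\<alpha>. g = G27 \<alpha> 0) \<or>
         (\<exists>\<beta> \<gamma>. g = G28 0 \<beta> \<gamma>) \<or>
         (\<exists>\<alpha> \<gamma>. g = G29 \<alpha> 0 \<gamma>) \<or>
         g = G30 0 \<or>
         g = G31 0 \<or>
         g = G32 0 \<or>
         (\<exists>\<alpha>. g = G33 \<alpha> 0) \<or>
         (\<exists>\<beta> \<gamma>. g = G34 0 \<beta> \<gamma>) \<or>
         (\<exists>\<alpha> \<gamma>. g = G35 \<alpha> 0 \<gamma>) \<or>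
         g = G36 0 \<or>
         g = G37 0 \<or>
         g = G38 0 \<or>
         g = G44 \<or>
         (\<exists>\<alpha>. g = G45 \<alpha>) \<or>
         g = G46 \<or>
         g = G49 \<or>
         (\<exists>\<beta> \<gamma>. g = G52 0 \<beta> \<gamma>) \<or>
         (\<exists>\<alpha> \<gamma>. g = G53 \<alpha> 0 \<gamma>) \<or>
         (\<exists>\<alpha> \<gamma>. g = G54 \<alpha> 0 \<gamma>) \<or>
         (\<exists>\<alpha> \<beta>. g = G55 \<alpha> \<beta> 0) \<or>
         (\<exists>\<alpha>. g = G58 \<alpha> 0)))"
  using nilpotent_gd_iff [of g] solvable_gd_iff [OF assms] by simp

end
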